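(* Let $\{x_t\},\{\bar x_t\},\{y_t\}$ be generated by the AC-PDHG iteration (defined in the context) with parameters $\eta_t>0$, $\tau_t\ge 0$, $\mu_d>0$, $\beta\in(0,1)$ satisfying $$\tau_1=0,\qquad \beta_1=0,\qquad \beta_t=\beta>0\ \ (t\ge 2),$$ $$\eta_2\le \min\Big\{(1-\beta)\eta_1,\ \frac{\mu_d}{4L_{A,1}^2}\Big\},$$ $$\eta_t\le\min\Big\{2(1-\beta)^2\eta_{t-1},\ \frac{\tau_{t-2}+\mu_d}{\tau_{t-1}}\eta_{t-1},\ \frac{\tau_{t-1}}{4L_{A,t-1}^2}\Big\},\qquad t\ge 3.$$ Then for every $k\ge 2$ and every $z=(x,y)\in Z$, $$Q(\widehat z_k,z)-\frac{\mu_d}{2}\|\widetilde y_0-y\|^2+\frac{\mu_d}{2}\|\widetilde y_0-\widehat y_k\|^2+\frac{\mu_d}{2}\|\widetilde y_k-y\|^2\le \frac{1}{\sum_{t=1}^k\eta_{t+1}}\Big[\frac{\|x_0-x\|^2}{2\beta}+\Big(\frac{5\eta_2L_{A,1}^2}{4\mu_d}-\frac{\eta_2}{2\eta_1}\Big)\|x_1-x_0\|^2-\frac{\|\bar x_{k+1}-x\|^2}{2\beta}\Big],$$ where $$\widehat x_k=\frac{\sum_{t=1}^k\eta_{t+1}x_t}{\sum_{t=1}^k\eta_{t+1}},\quad \widehat y_k=\frac{\sum_{t=1}^k\eta_{t+1}y_t}{\sum_{t=1}^k\eta_{t+1}},\quad \widehat z_k=(\widehat x_k,\widehat y_k),$$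 $$\widetilde y_k=\frac{\sum_{t=1}^{k-1}\big(\eta_{t+1}(\mu_d+\tau_t)-\eta_{t+2}\tau_{t+1}\big)y_t+\eta_{k+1}(\mu_d+\tau_k)y_k}{\mu_d\sum_{t=1}^k\eta_{t+1}}.$$
   Context: Setting: $X\subseteq\mathbb{R}^n$ and $Y\subseteq\mathbb{R}^m$ are nonempty closed convex sets, $Z=X\times Y$, $A\in\mathbb{R}^{m\times n}$, and $f:X\to\mathbb{R}$, $g:Y\to\mathbb{R}$ are proper, lower semicontinuous, convex functions. All norms are Euclidean. The problem $\min_{x\in X}\max_{y\in Y} f(x)+\langle Ax,y\rangle-g(y)$ is assumed to have a saddle point. For $\bar z=(\bar x,\bar y)\in Z$ and $z=(x,y)\in Z$, the gap function is $Q(\bar z,z)=f(\bar x)+\langle A\bar x,y\rangle-g(y)-[f(x)+\langle Ax,\bar y\rangle-g(\bar y)]$. AC-PDHG iteration: given $x_0=\bar x_0\in X$, $\widetilde y_0\in Y$, $\mu_d>0$ and parameters $\beta_t\in[0,1)$, $\eta_t$, $\tau_t$, set $y_0=\arg\min_{y\in Y}\{\langle -Ax_0,y\rangle+g(y)+\frac{\mu_d}{2}\|\widetilde y_0-y\|^2\}$, and for $t=1,2,\dots$ - $x_t=\arg\min_{x\in X}\{\eta_t[\langle A^\top y_{t-1},x\rangle+f(x)]+\frac12\|\bar x_{t-1}-x\|^2\}$, - $\bar x_t=(1-\beta_t)\bar x_{t-1}+\beta_t x_t$, - $y_t=\arg\min_{y\in Y}\{\langle -Ax_t,y\rangle+g(y)+\frac{\mu_d}{2}\|\widetilde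 y_0-y\|^2+\frac{\tau_t}{2}\|y_{t-1}-y\|^2\}$. Local norm estimates: $L_{A,t}=\|A^\top(y_t-y_{t-1})\|/\|y_t-y_{t-1}\|$ for $t\ge1$. Conventions: $0/0=0$ and $a/0=+\infty$ for $a>0$. The parameters $\eta_t,\tau_t$ may depend on previously computed iterates. *)

theory Defs
  imports "HOL-Analysis.Analysis"
begin

definition lsc_on :: "'a::topological_space set \<Rightarrow> ('a \<Rightarrow> real) \<Rightarrow> bool" where
  "lsc_on S f \<longleftrightarrow> (\<forall>x\<in>S. \<forall>a. a < f x \<longrightarrow> (\<forall>\<^sub>F u in at x within S. a < f u))"

definition is_saddle_point ::
    "'a set \<Rightarrow> 'b set \<Rightarrow> ('a \<Rightarrow> 'b \<Rightarrow> real) \<Rightarrow> 'a \<times> 'b \<Rightarrow> bool" where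
  "is_saddle_point X Y \<phi> = (\<lambda>(xs, ys). xs \<in> X \<and> ys \<in> Y \<and>
     (\<forall>x\<in>X. \<forall>y\<in>Y. \<phi> xs y \<le> \<phi> xs ys \<and> \<phi> xs ys \<le> \<phi> x ys))"

definition gap ::
    "real^'n^'m \<Rightarrow> (real^'n \<Rightarrow> real) \<Rightarrow> (real^'m \<Rightarrow> real)
      \<Rightarrow> (real^'n) \<times> (real^'m) \<Rightarrow> (real^'n) \<times> (real^'m) \<Rightarrow> real" where
  "gap A f g = (\<lambda>(xb, yb) (x, y).
     f xb + inner (A *v xb) y - g y - (f x + inner (A *v x) yb - g yb))"

text \<open>\<open>xb\<close> is the averaged primal sequence and \<open>y0t\<close> the dual prox center.
  The step parameters are arbitrary real sequences, which covers parameters chosen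
  adaptively from the iterates.\<close>

definition ac_pdhg ::
    "(real^'n) set \<Rightarrow> (real^'m) set \<Rightarrow> real^'n^'m \<Rightarrow> (real^'n \<Rightarrow> real) \<Rightarrow> (real^'m \<Rightarrow> real)
      \<Rightarrow> real \<Rightarrow> (nat \<Rightarrow> real) \<Rightarrow> (nat \<Rightarrow> real) \<Rightarrow> (nat \<Rightarrow> real) \<Rightarrow> real^'m
      \<Rightarrow> (nat \<Rightarrow> real^'n) \<Rightarrow> (nat \<Rightarrow> real^'n) \<Rightarrow> (nat \<Rightarrow> real^'m) \<Rightarrow> bool" where
  "ac_pdhg X Y A f g \<mu> \<beta> \<eta> \<tau> y0t x xb y \<longleftrightarrow>
     x 0 \<in> X \<and> xb 0 = x 0 \<and> y0t \<in> Y \<and> (\<forall>t\<ge>1. 0 \<le> \<beta> t \<and> \<beta> t < 1) \<and>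
     is_arg_min (\<lambda>v. inner (- (A *v x 0)) v + g v + \<mu> / 2 * (norm (y0t - v))\<^sup>2)
       (\<lambda>v. v \<in> Y) (y 0) \<and>
     (\<forall>t\<ge>1.
       is_arg_min (\<lambda>u. \<eta> t * (inner (transpose A *v y (t - 1)) u + f u)
                          + 1 / 2 * (norm (xb (t - 1) - u))\<^sup>2)
         (\<lambda>u. u \<in> X) (x t) \<and>
       xb t = (1 - \<beta> t) *\<^sub>R xb (t - 1) + \<beta> t *\<^sub>R x t \<and>
       is_arg_min (\<lambda>v. inner (- (A *v x t)) v + g v + \<mu> / 2 * (norm (y0t - v))\<^sup>2
                          + \<tau> t / 2 * (norm (y (t - 1) - v))\<^sup>2)
         (\<lambda>v. v \<in> Y) (y t))"

text \<open>The numerator vanishes whenever the denominator does, so real division agrees with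
  the convention \<open>0 / 0 = 0\<close> and the value \<open>\<infinity>\<close> never arises here.\<close>

definition local_norm :: "real^'n^'m \<Rightarrow> (nat \<Rightarrow> real^'m) \<Rightarrow> nat \<Rightarrow> real" where
  "local_norm A y t =
     norm (transpose A *v (y t - y (t - 1))) / norm (y t - y (t - 1))"

text \<open>The step-size bounds are compared in \<^typ>\<open>ereal\<close>, where \<open>0 / 0 = 0\<close> and
  \<open>a / 0 = \<infinity>\<close> for \<open>a > 0\<close>; the denominators below may be zero.\<close>

definition stepsize_rule ::
    "real \<Rightarrow> real \<Rightarrow> (nat \<Rightarrow> real) \<Rightarrow> (nat \<Rightarrow> real) \<Rightarrow> (nat \<Rightarrow> real) \<Rightarrow> bool" where
  "stepsize_rule \<mu> b L \<eta> \<tau> \<longleftrightarrow>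
     ereal (\<eta> 2) \<le> min (ereal ((1 - b) * \<eta> 1)) (ereal \<mu> / ereal (4 * (L 1)\<^sup>2)) \<and>
     (\<forall>t\<ge>3. ereal (\<eta> t) \<le>
        min (ereal (2 * (1 - b)\<^sup>2 * \<eta> (t - 1)))
          (min (ereal (\<tau> (t - 2) + \<mu>) / ereal (\<tau> (t - 1)) * ereal (\<eta> (t - 1)))
               (ereal (\<tau> (t - 1)) / ereal (4 * (L (t - 1))\<^sup>2))))"

definition step_sum :: "(nat \<Rightarrow> real) \<Rightarrow> nat \<Rightarrow> real" where
  "step_sum \<eta> k = (\<Sum>t=1..k. \<eta> (t + 1))"

definition step_avg :: "(nat \<Rightarrow> real) \<Rightarrow> (nat \<Rightarrow> 'a::real_vector) \<Rightarrow> nat \<Rightarrow> 'a" where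
  "step_avg \<eta> w k = (1 / step_sum \<eta> k) *\<^sub>R (\<Sum>t=1..k. \<eta> (t + 1) *\<^sub>R w t)"

definition y_tilde ::
    "real \<Rightarrow> (nat \<Rightarrow> real) \<Rightarrow> (nat \<Rightarrow> real) \<Rightarrow> (nat \<Rightarrow> 'a::real_vector) \<Rightarrow> nat \<Rightarrow> 'a" where
  "y_tilde \<mu> \<eta> \<tau> y k = (1 / (\<mu> * step_sum \<eta> k)) *\<^sub>R
     ((\<Sum>t=1..<k. (\<eta> (t + 1) * (\<mu> + \<tau> t) - \<eta> (t + 2) * \<tau> (t + 1)) *\<^sub>R y t)
      + (\<eta> (k + 1) * (\<mu> + \<tau> k)) *\<^sub>R y k)"

end

theory Submission
  imports Defs
begin

text \<open>
  Two facts about the iteration carry the proof: each prox step minimises a strongly convex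
  function, so its minimiser satisfies a three-point inequality (\<open>prox_three_point\<close>), and
  \<open>xb (t + 1)\<close> is a convex combination of \<open>xb t\<close> and \<open>x (t + 1)\<close>. Write the gap at
  \<open>(x t, y t)\<close> as the dual inequality at \<open>t\<close>, plus the primal inequality at
  \<open>t + 1\<close> tested at \<open>u\<close>, plus the primal inequality at \<open>t\<close> tested at
  \<open>x (t + 1)\<close>, plus the coupling of \<open>y t - y (t - 1)\<close> with \<open>A (x t - x (t + 1))\<close>.
  After weighting with \<open>\<eta> (t + 1)\<close> the distances from \<open>xb\<close> to \<open>u\<close> telescope
  with factor \<open>1 / (2 * b)\<close>, and a residual is left (\<open>one_step\<close>).

  The heart of the proof is that the residuals telescope too. The step-size rule lets the dual
  prox term absorb the coupling up to \<open>(norm (x t - x (t + 1)))\<^sup>2 / 8\<close>. A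
  single iteration need not absorb that remainder, but with the potential
  \<open>D t = (norm (xb (t - 1) - x t))\<^sup>2\<close> the residual at \<open>t \<ge> 2\<close> is at most
  \<open>(D t - D (t + 1)) / 4\<close>; this is an inequality between quadratic forms in two vectors
  (\<open>extrapolation_form_bound\<close>). At \<open>t = 1\<close> the parameter \<open>\<tau> 1\<close> vanishes, and
  strong convexity of the dual subproblems bounds \<open>y 1 - y 0\<close> by
  \<open>x 1 - x 0\<close> instead (\<open>first_dual_move\<close>); this produces the
  \<open>(norm (x 1 - x 0))\<^sup>2\<close> term of the bound.

  Summing over \<open>t\<close> and regrouping the dual distances by Abel summation gives them exactly
  the weights that define \<^const>\<open>y_tilde\<close>. The claim then follows from Jensen's inequality,
  applied to the gap, to the distance from the prox center, and to the distance from \<open>v\<close>.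
\<close>

section \<open>Prox steps and averages of convex functions\<close>

lemma norm_sq_convex_combination:
  fixes p m w :: "'a::real_inner"
  shows "(norm (p - ((1 - s) *\<^sub>R m + s *\<^sub>R w)))\<^sup>2
       = (1 - s) * (norm (p - m))\<^sup>2 + s * (norm (p - w))\<^sup>2 - s * (1 - s) * (norm (m - w))\<^sup>2"
  unfolding power2_norm_eq_inner
  by (simp add: inner_diff_left inner_diff_right inner_add_left inner_add_right inner_commute
      algebra_simps power2_eq_square)

text \<open>The objective of a prox step is strongly convex with modulus \<open>a + c\<close>, so it exceeds its
  minimum by at least a quadratic. Comparing the minimiser \<open>m\<close> with the point at fraction
  \<open>s\<close> of the way to \<open>w\<close> and letting \<open>s\<close> tend to \<open>0\<close> proves this without any
  differentiability of \<open>h\<close>.\<close>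

lemma prox_three_point:
  fixes C :: "'a::real_inner set"
  assumes conv: "convex_on C h"
    and min: "is_arg_min (\<lambda>w. h w + a / 2 * (norm (p - w))\<^sup>2 + c / 2 * (norm (q - w))\<^sup>2)
               (\<lambda>w. w \<in> C) m"
    and w: "w \<in> C"
  shows "h m + a / 2 * (norm (p - m))\<^sup>2 + c / 2 * (norm (q - m))\<^sup>2 + (a + c) / 2 * (norm (m - w))\<^sup>2
       \<le> h w + a / 2 * (norm (p - w))\<^sup>2 + c / 2 * (norm (q - w))\<^sup>2"
proof -
  define \<phi> where "\<phi> w = h w + a / 2 * (norm (p - w))\<^sup>2 + c / 2 * (norm (q - w))\<^sup>2" for w
  define M where "M = (a + c) / 2 * (norm (m - w))\<^sup>2"
  have m: "m \<in> C" and le: "\<And>z. z \<in> C \<Longrightarrow> \<phi> m \<le> \<phi> z"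
    using min unfolding is_arg_min_def \<phi>_def by force+
  have C: "convex C" using conv by (simp add: convex_on_def)
  have bound: "\<phi> m + (1 - s) * M \<le> \<phi> w" if s: "0 < s" "s < 1" for s
  proof -
    let ?z = "(1 - s) *\<^sub>R m + s *\<^sub>R w"
    have "?z \<in> C" using C m w s by (simp add: convex_alt)
    then have "\<phi> m \<le> \<phi> ?z" by (rule le)
    also have "\<dots> \<le> ((1 - s) * h m + s * h w) + a / 2 * (norm (p - ?z))\<^sup>2
        + c / 2 * (norm (q - ?z))\<^sup>2"
      using convex_onD[OF conv, of s m w] m w s by (simp add: \<phi>_def)
    also have "\<dots> = (1 - s) * \<phi> m + s * \<phi> w - s * (1 - s) * M"
      unfolding norm_sq_convex_combination \<phi>_def M_def by (simp add: field_simps)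
    finally have "s * (\<phi> m + (1 - s) * M) \<le> s * \<phi> w" by (simp add: algebra_simps)
    then show ?thesis using s by simp
  qed
  have "((\<lambda>s. \<phi> m + (1 - s) * M) \<longlongrightarrow> \<phi> m + (1 - 0) * M) (at_right 0)"
    by (intro tendsto_intros)
  moreover have "\<forall>\<^sub>F s in at_right 0. \<phi> m + (1 - s) * M \<le> \<phi> w"
    unfolding eventually_at_right_field using bound by (intro exI[of _ 1]) auto
  ultimately have "\<phi> m + (1 - 0) * M \<le> \<phi> w"
    by (intro tendsto_upperbound) auto
  then show ?thesis by (simp add: \<phi>_def M_def)
qed

lemma convex_on_linear_plus:
  assumes "convex_on C h"
  shows "convex_on C (\<lambda>w. inner p w + h w)"
proof -
  have "convex_on C (\<lambda>w. inner p w)"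
    using assms by (simp add: convex_on_def inner_add_right)
  then show ?thesis using assms by (rule convex_on_add)
qed

lemma Jensen_weighted_sum:
  fixes w :: "'i \<Rightarrow> 'a::real_vector"
  assumes "finite I" "convex_on C h" "\<And>i. i \<in> I \<Longrightarrow> a i \<ge> 0" "\<And>i. i \<in> I \<Longrightarrow> w i \<in> C"
    and s: "(\<Sum>i\<in>I. a i) = s" "s > 0"
  shows "s * h ((1 / s) *\<^sub>R (\<Sum>i\<in>I. a i *\<^sub>R w i)) \<le> (\<Sum>i\<in>I. a i * h (w i))"
proof -
  have "I \<noteq> {}" using s by auto
  moreover have "(\<Sum>i\<in>I. a i / s) = 1" using s by (simp flip: sum_divide_distrib)
  ultimately have "h (\<Sum>i\<in>I. (a i / s) *\<^sub>R w i) \<le> (\<Sum>i\<in>I. a i / s * h (w i))"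
    using assms by (intro convex_on_sum[of I C]) auto
  then have "s * h (\<Sum>i\<in>I. (a i / s) *\<^sub>R w i) \<le> s * (\<Sum>i\<in>I. a i / s * h (w i))"
    using s(2) by (intro mult_left_mono) auto
  moreover have "(1 / s) *\<^sub>R (\<Sum>i\<in>I. a i *\<^sub>R w i) = (\<Sum>i\<in>I. (a i / s) *\<^sub>R w i)"
    by (simp add: scaleR_sum_right)
  moreover have "s * (\<Sum>i\<in>I. a i / s * h (w i)) = (\<Sum>i\<in>I. a i * h (w i))"
    using s(2) by (simp add: sum_distrib_left)
  ultimately show ?thesis by simp
qed

lemma convex_on_norm_sq_diff:
  fixes p :: "'a::real_inner"
  shows "convex_on UNIV (\<lambda>w. (norm (p - w))\<^sup>2)"
  by (intro convex_onI) (auto simp: norm_sq_convex_combination)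

section \<open>Scalar and quadratic-form estimates\<close>

text \<open>In the extended reals \<open>a / 0\<close> is \<open>\<infinity>\<close> or \<open>0\<close> according to whether
  \<open>a > 0\<close> or \<open>a = 0\<close>. A positive lower bound on the quotient excludes the second case,
  so clearing the denominator is legitimate even when it vanishes.\<close>

lemma pos_le_ereal_divide:
  assumes "e > 0" "c \<ge> 0" "a \<ge> 0" "ereal e \<le> ereal a / ereal c"
  shows "a > 0" "e * c \<le> a"
proof -
  have "a \<noteq> 0" using assms by (cases "c = 0") (auto simp flip: zero_ereal_def)
  then show "a > 0" using assms by simp
  show "e * c \<le> a"
  proof (cases "c = 0")
    case False
    then show ?thesis using assms by (auto simp: field_simps)
  qed (use assms in simp)
qed

lemma young_product:
  fixes p q :: real
  shows "p * q \<le> p\<^sup>2 / 4 + q\<^sup>2"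
  using zero_le_power2[of "p / 2 - q"] by (simp add: power2_eq_square algebra_simps)

text \<open>The weight of \<open>y t\<close> in the numerator of \<^const>\<open>y_tilde\<close>.\<close>

definition dual_weight :: "real \<Rightarrow> (nat \<Rightarrow> real) \<Rightarrow> (nat \<Rightarrow> real) \<Rightarrow> nat \<Rightarrow> nat \<Rightarrow> real" where
  "dual_weight \<mu> \<eta> \<tau> k t = (if t < k then \<eta> (t + 1) * (\<mu> + \<tau> t) - \<eta> (t + 2) * \<tau> (t + 1)
     else \<eta> (t + 1) * (\<mu> + \<tau> t))"

lemma sum_dual_weight:
  fixes F :: "nat \<Rightarrow> 'a::real_vector"
  assumes "k \<ge> 1"
  shows "(\<Sum>t=1..k. dual_weight \<mu> \<eta> \<tau> k t *\<^sub>R F t)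
       = (\<Sum>t=1..<k. (\<eta> (t + 1) * (\<mu> + \<tau> t) - \<eta> (t + 2) * \<tau> (t + 1)) *\<^sub>R F t)
         + (\<eta> (k + 1) * (\<mu> + \<tau> k)) *\<^sub>R F k"
proof -
  have "{1..k} = insert k {1..<k}" using assms by auto
  then show ?thesis by (simp add: dual_weight_def add.commute)
qed

text \<open>Abel summation: with \<open>N t\<close> the squared distance of \<open>y t\<close> to a dual test point,
  it collects what two consecutive dual prox steps say about the same distance.
  For constant \<open>N\<close> it gives the total weight.\<close>

lemma dual_weight_summation:
  assumes "k \<ge> 1" "\<tau> 1 = 0"
  shows "(\<Sum>t=1..k. \<eta> (t + 1) * ((\<mu> + \<tau> t) * N t - \<tau> t * N (t - 1)))
       = (\<Sum>t=1..k. dual_weight \<mu> \<eta> \<tau> k t * N t)"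
  unfolding sum_dual_weight[OF assms(1), of \<mu> \<eta> \<tau> N, unfolded real_scaleR_def]
  using assms(1)
proof (induction k rule: nat_induct_at_least)
  case base
  then show ?case using assms(2) by simp
next
  case (Suc k)
  then show ?case by (simp add: algebra_simps)
qed

lemma dual_weight_total:
  assumes "k \<ge> 1" "\<tau> 1 = 0"
  shows "(\<Sum>t=1..k. dual_weight \<mu> \<eta> \<tau> k t) = \<mu> * step_sum \<eta> k"
  using dual_weight_summation[where N = "\<lambda>_. 1" and \<tau> = \<tau> and k = k, OF assms]
  by (simp add: step_sum_def sum_distrib_left mult.commute)

text \<open>The discriminant test for binary quadratic forms, with vectors in place of scalars;
  completing the square works in any inner product space.\<close>

lemma quadratic_form_nonneg:
  fixes p w :: "'a::real_inner"
  assumes "\<alpha> > 0" "\<gamma>\<^sup>2 \<le> 4 * \<alpha> * \<delta>"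
  shows "\<alpha> * (norm w)\<^sup>2 + \<gamma> * inner p w + \<delta> * (norm p)\<^sup>2 \<ge> 0"
proof -
  have "0 \<le> (norm (w + (\<gamma> / (2 * \<alpha>)) *\<^sub>R p))\<^sup>2" by simp
  also have "\<dots> = (norm w)\<^sup>2 + \<gamma> / \<alpha> * inner p w + (\<gamma>\<^sup>2 / (4 * \<alpha>\<^sup>2)) * (norm p)\<^sup>2"
    using assms(1) unfolding power2_norm_eq_inner
    by (simp add: inner_add_left inner_add_right inner_commute field_simps power2_eq_square)
  finally have "0 \<le> \<alpha> * ((norm w)\<^sup>2 + \<gamma> / \<alpha> * inner p w + (\<gamma>\<^sup>2 / (4 * \<alpha>\<^sup>2)) * (norm p)\<^sup>2)"
    using assms(1) by simp
  also have "\<dots> = \<alpha> * (norm w)\<^sup>2 + \<gamma> * inner p w + (\<gamma>\<^sup>2 / (4 * \<alpha>)) * (norm p)\<^sup>2"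
    using assms(1) by (simp add: field_simps power2_eq_square)
  also have "\<dots> \<le> \<alpha> * (norm w)\<^sup>2 + \<gamma> * inner p w + \<delta> * (norm p)\<^sup>2"
    using assms by (intro add_left_mono mult_right_mono) (auto simp: field_simps)
  finally show ?thesis .
qed

text \<open>The difference of the two sides is affine in \<open>\<theta>\<close>, so only the endpoints \<open>\<theta> = 0\<close> and
  \<open>\<theta> = 2 * (1 - b)\<^sup>2\<close> matter, and each of them is a binary quadratic form. The factor
  \<open>1 / 4\<close> on the right makes both forms semidefinite for every \<open>b\<close>, and since it is the
  same on both squares the bound telescopes. In the iteration \<open>p\<close> is
  \<open>xb (t - 1) - x t\<close>, \<open>w\<close> is \<open>x t - x (t + 1)\<close>, and \<open>\<theta>\<close> is
  \<open>\<eta> (t + 1) / \<eta> t\<close>.\<close>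

lemma extrapolation_form_bound:
  fixes p w :: "'a::real_inner"
  assumes b: "0 < b" "b < 1" and \<theta>: "0 \<le> \<theta>" "\<theta> \<le> 2 * (1 - b)\<^sup>2"
  shows "(norm w)\<^sup>2 / 8 + \<theta> * inner p w - (1 - b / 2) * (norm ((1 - b) *\<^sub>R p + w))\<^sup>2
       \<le> ((norm p)\<^sup>2 - (norm ((1 - b) *\<^sub>R p + w))\<^sup>2) / 4"
proof -
  define c where "c = (1 - b) *\<^sub>R p"
  define r where "r = 1 - b"
  have r: "0 < r" "r < 1" using b by (auto simp: r_def)
  have quarter: "(1 + 2 * r) / 4 = 1 / 4 + r / 2" by simp
  define S where "S = (norm (c + w))\<^sup>2"
  define W where "W = (norm w)\<^sup>2"
  define I where "I = inner c w"
  define P where "P = (norm p)\<^sup>2"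
  have cP: "(norm c)\<^sup>2 = r\<^sup>2 * P" unfolding c_def P_def r_def by (simp add: power_mult_distrib)
  have S: "S = r\<^sup>2 * P + 2 * I + W"
    unfolding S_def W_def I_def cP[symmetric] power2_norm_eq_inner
    by (simp add: inner_add_left inner_add_right inner_commute)
  have "P \<ge> 0" "W \<ge> 0" by (auto simp: P_def W_def)
  \<comment> \<open>The endpoint \<open>\<theta> = 0\<close>.\<close>
  have end0: "W / 8 - (1 + 2 * r) / 4 * S \<le> P / 4"
  proof -
    have "W \<le> 2 * S + 2 * (r\<^sup>2 * P)"
    proof -
      have "0 \<le> (norm (c + (c + w)))\<^sup>2" by simp
      also have "\<dots> = 2 * S + 2 * (r\<^sup>2 * P) - W"
        unfolding S_def W_def cP[symmetric] power2_norm_eq_inner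
        by (simp add: inner_add_left inner_add_right inner_commute)
      finally show ?thesis by simp
    qed
    moreover have "r\<^sup>2 * P \<le> P"
      using \<open>P \<ge> 0\<close> r by (simp add: mult_left_le_one_le power_le_one)
    moreover have "0 \<le> r * S" using r by (simp add: S_def)
    moreover have "(1 + 2 * r) / 4 * S = S / 4 + (r * S) / 2"
      unfolding quarter by (simp add: algebra_simps)
    ultimately show ?thesis using \<open>W \<ge> 0\<close> by linarith
  qed
  \<comment> \<open>The endpoint \<open>\<theta> = 2 * (1 - b)\<^sup>2\<close>.\<close>
  have end1: "W / 8 + 2 * r * I - (1 + 2 * r) / 4 * S \<le> P / 4"
  proof -
    have "0 \<le> (1 / 8 + r / 2) * (norm w)\<^sup>2 + (1 / 2 - r) * inner c w
        + ((1 + 2 * r) / 4 + 1 / (4 * r\<^sup>2)) * (norm c)\<^sup>2"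
    proof (rule quadratic_form_nonneg)
      show "1 / 8 + r / 2 > 0" using r by simp
      have "1 \<le> 1 / r\<^sup>2" using r by (simp add: power_le_one)
      moreover have "1 / (4 * r\<^sup>2) = (1 / r\<^sup>2) / 4" by simp
      ultimately have "1 / 2 \<le> (1 + 2 * r) / 4 + 1 / (4 * r\<^sup>2)"
        using r quarter by linarith
      then have "4 * (1 / 8 + r / 2) * (1 / 2) \<le> 4 * (1 / 8 + r / 2) * ((1 + 2 * r) / 4 + 1 / (4 * r\<^sup>2))"
        using r by (intro mult_left_mono) auto
      moreover have "(1 / 2 - r)\<^sup>2 \<le> 4 * (1 / 8 + r / 2) * (1 / 2)"
      proof -
        have "(1 / 2 - r)\<^sup>2 = 1 / 4 - r * (1 - r)" by (simp add: power2_eq_square algebra_simps)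
        also have "\<dots> \<le> 1 / 4 + r" using r by (simp add: algebra_simps)
        also have "\<dots> \<le> 4 * (1 / 8 + r / 2) * (1 / 2)" using r by simp
        finally show ?thesis .
      qed
      ultimately show "(1 / 2 - r)\<^sup>2 \<le> 4 * (1 / 8 + r / 2) * ((1 + 2 * r) / 4 + 1 / (4 * r\<^sup>2))"
        by linarith
    qed
    also have "\<dots> = (1 / 8 + r / 2) * W + (1 / 2 - r) * I + (1 + 2 * r) / 4 * (r\<^sup>2 * P) + P / 4"
      using r unfolding cP W_def I_def by (simp add: field_simps)
    finally show ?thesis unfolding S quarter by (simp add: algebra_simps)
  qed
  define s where "s = \<theta> / (2 * r\<^sup>2)"
  have s: "0 \<le> s" "s \<le> 1" using \<theta> r by (auto simp: s_def r_def field_simps)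
  have "\<theta> * inner p w = s * (2 * r * I)"
    using r unfolding s_def I_def c_def r_def[symmetric] by (simp add: power2_eq_square)
  moreover have "E + s * J \<le> P / 4" if "E + J \<le> P / 4" "E \<le> P / 4" for E J
  proof -
    have "E + s * J = s * (E + J) + (1 - s) * E" by (simp add: algebra_simps)
    also have "\<dots> \<le> s * (P / 4) + (1 - s) * (P / 4)"
      using s that by (intro add_mono mult_left_mono) auto
    also have "\<dots> = P / 4" by (simp flip: distrib_right)
    finally show ?thesis .
  qed
  from this[of "W / 8 - (1 + 2 * r) / 4 * S" "2 * r * I"] end0 end1
  have "W / 8 - (1 + 2 * r) / 4 * S + s * (2 * r * I) \<le> P / 4" by simp
  ultimately have "W / 8 + \<theta> * inner p w - (1 / 4 + r / 2) * S \<le> P / 4"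
    unfolding quarter by simp
  moreover have "(1 / 4 + r / 2) * S = (1 - b / 2) * S - S / 4"
    by (simp add: r_def left_diff_distrib distrib_right diff_divide_distrib)
  ultimately have "W / 8 + \<theta> * inner p w - (1 - b / 2) * S \<le> (P - S) / 4" by simp
  then show ?thesis unfolding W_def S_def P_def c_def .
qed

section \<open>One iteration\<close>

locale ac_pdhg_run =
  fixes X :: "(real^'n) set" and Y :: "(real^'m) set"
    and A :: "real^'n^'m"
    and f :: "real^'n \<Rightarrow> real" and g :: "real^'m \<Rightarrow> real"
    and \<mu> b :: real and \<beta> \<eta> \<tau> :: "nat \<Rightarrow> real"
    and y0t :: "real^'m"
    and x xb :: "nat \<Rightarrow> real^'n" and y :: "nat \<Rightarrow> real^'m"
  assumes convex_f: "convex_on X f" and convex_g: "convex_on Y g"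
    and mu_pos: "\<mu> > 0" and b_pos: "0 < b" and b_less_1: "b < 1"
    and eta_pos: "\<And>t. t \<ge> 1 \<Longrightarrow> \<eta> t > 0"
    and tau_nonneg: "\<And>t. t \<ge> 1 \<Longrightarrow> \<tau> t \<ge> 0"
    and tau_1: "\<tau> 1 = 0" and beta_1: "\<beta> 1 = 0" and beta: "\<And>t. t \<ge> 2 \<Longrightarrow> \<beta> t = b"
    and run: "ac_pdhg X Y A f g \<mu> \<beta> \<eta> \<tau> y0t x xb y"
    and rule: "stepsize_rule \<mu> b (local_norm A y) \<eta> \<tau>"
begin

abbreviation L :: "nat \<Rightarrow> real" where "L \<equiv> local_norm A y"

lemma xb_0: "xb 0 = x 0"
  using run by (simp add: ac_pdhg_def)

lemma xb_1: "xb 1 = x 0"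
  using run beta_1 by (simp add: ac_pdhg_def)

lemma xb_Suc:
  assumes "t \<ge> 1"
  shows "xb (t + 1) = (1 - b) *\<^sub>R xb t + b *\<^sub>R x (t + 1)"
proof -
  have "xb (t + 1) = (1 - \<beta> (t + 1)) *\<^sub>R xb (t + 1 - 1) + \<beta> (t + 1) *\<^sub>R x (t + 1)"
    using run unfolding ac_pdhg_def by (metis le_add2)
  then show ?thesis using beta[of "t + 1"] assms by simp
qed

lemma x_argmin:
  assumes "t \<ge> 1"
  shows "is_arg_min (\<lambda>u. \<eta> t * (inner (transpose A *v y (t - 1)) u + f u)
                          + 1 / 2 * (norm (xb (t - 1) - u))\<^sup>2) (\<lambda>u. u \<in> X) (x t)"
  using run assms by (simp add: ac_pdhg_def)

lemma y_argmin:
  assumes "t \<ge> 1"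
  shows "is_arg_min (\<lambda>v. inner (- (A *v x t)) v + g v + \<mu> / 2 * (norm (y0t - v))\<^sup>2
                          + \<tau> t / 2 * (norm (y (t - 1) - v))\<^sup>2) (\<lambda>v. v \<in> Y) (y t)"
  using run assms by (simp add: ac_pdhg_def)

lemma y_argmin_0:
  "is_arg_min (\<lambda>v. inner (- (A *v x 0)) v + g v + \<mu> / 2 * (norm (y0t - v))\<^sup>2)
     (\<lambda>v. v \<in> Y) (y 0)"
  using run by (simp add: ac_pdhg_def)

lemma x_in_X: "x t \<in> X"
proof (cases t)
  case 0
  then show ?thesis using run by (simp add: ac_pdhg_def)
next
  case (Suc s)
  then show ?thesis using x_argmin[of t] by (simp add: is_arg_min_def)
qed

lemma y_in_Y: "y t \<in> Y"
proof (cases t)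
  case 0
  then show ?thesis using y_argmin_0 by (simp add: is_arg_min_def)
next
  case (Suc s)
  then show ?thesis using y_argmin[of t] by (simp add: is_arg_min_def)
qed

lemma inner_transpose: "inner (transpose A *v q) w = inner q (A *v w)"
  by (simp add: dot_lmul_matrix)

lemma primal_prox:
  assumes t: "t \<ge> 1" and w: "w \<in> X"
  shows "\<eta> t * (inner (y (t - 1)) (A *v (x t - w)) + f (x t) - f w)
         + (norm (xb (t - 1) - x t))\<^sup>2 / 2 + (norm (x t - w))\<^sup>2 / 2
       \<le> (norm (xb (t - 1) - w))\<^sup>2 / 2"
proof -
  let ?h = "\<lambda>u. \<eta> t * (inner (transpose A *v y (t - 1)) u + f u)"
  have "convex_on X ?h"
    using eta_pos[OF t] by (intro convex_on_cmul convex_on_linear_plus convex_f) simp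
  then have "?h (x t) + 1 / 2 * (norm (xb (t - 1) - x t))\<^sup>2 + 0 / 2 * (norm (0 - x t))\<^sup>2
        + (1 + 0) / 2 * (norm (x t - w))\<^sup>2
      \<le> ?h w + 1 / 2 * (norm (xb (t - 1) - w))\<^sup>2 + 0 / 2 * (norm (0 - w))\<^sup>2"
    using x_argmin[OF t] w by (intro prox_three_point) simp_all
  then show ?thesis
    by (simp add: inner_transpose matrix_vector_mult_diff_distrib inner_diff_right algebra_simps
        del: transpose_matrix_vector)
qed

lemma dual_prox:
  assumes t: "t \<ge> 1" and v: "v \<in> Y"
  shows "inner (A *v x t) (v - y t) + g (y t) - g v
         + \<mu> / 2 * (norm (y0t - y t))\<^sup>2 + \<tau> t / 2 * (norm (y (t - 1) - y t))\<^sup>2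
         + (\<mu> + \<tau> t) / 2 * (norm (y t - v))\<^sup>2
       \<le> \<mu> / 2 * (norm (y0t - v))\<^sup>2 + \<tau> t / 2 * (norm (y (t - 1) - v))\<^sup>2"
  using prox_three_point[OF convex_on_linear_plus[OF convex_g] y_argmin[OF t] v]
  by (simp add: inner_diff_right)

lemma dual_prox_0:
  assumes v: "v \<in> Y"
  shows "inner (A *v x 0) (v - y 0) + g (y 0) - g v
         + \<mu> / 2 * (norm (y0t - y 0))\<^sup>2 + \<mu> / 2 * (norm (y 0 - v))\<^sup>2
       \<le> \<mu> / 2 * (norm (y0t - v))\<^sup>2"
proof -
  have "inner (- (A *v x 0)) (y 0) + g (y 0) + \<mu> / 2 * (norm (y0t - y 0))\<^sup>2
        + 0 / 2 * (norm (0 - y 0))\<^sup>2 + (\<mu> + 0) / 2 * (norm (y 0 - v))\<^sup>2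
      \<le> inner (- (A *v x 0)) v + g v + \<mu> / 2 * (norm (y0t - v))\<^sup>2 + 0 / 2 * (norm (0 - v))\<^sup>2"
    using y_argmin_0 v
    by (intro prox_three_point[OF convex_on_linear_plus[OF convex_g]]) simp_all
  then show ?thesis by (simp add: inner_diff_right)
qed

lemma local_norm_nonneg: "L t \<ge> 0"
  by (simp add: local_norm_def)

lemma coupling_bound:
  "inner (y t - y (t - 1)) (A *v w) \<le> L t * norm (y t - y (t - 1)) * norm w"
proof -
  have "norm (transpose A *v (y t - y (t - 1))) = L t * norm (y t - y (t - 1))"
    by (cases "y t = y (t - 1)") (auto simp: local_norm_def)
  then show ?thesis
    using norm_cauchy_schwarz[of "transpose A *v (y t - y (t - 1))" w]
    by (simp add: inner_transpose del: transpose_matrix_vector)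
qed

lemma stepsize_first:
  shows "\<eta> 2 \<le> (1 - b) * \<eta> 1" "\<eta> 2 * (4 * (L 1)\<^sup>2) \<le> \<mu>"
proof -
  have "ereal (\<eta> 2) \<le> ereal ((1 - b) * \<eta> 1)"
    and le: "ereal (\<eta> 2) \<le> ereal \<mu> / ereal (4 * (L 1)\<^sup>2)"
    using rule unfolding stepsize_rule_def min.bounded_iff by blast+
  then show "\<eta> 2 \<le> (1 - b) * \<eta> 1" by simp
  show "\<eta> 2 * (4 * (L 1)\<^sup>2) \<le> \<mu>"
    using eta_pos[of 2] mu_pos by (intro pos_le_ereal_divide(2)[OF _ _ _ le]) auto
qed

text \<open>The third bound forces \<open>\<tau> t > 0\<close>, which gives the quotient in the second one its
  ordinary meaning.\<close>

lemma stepsize_later: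
  assumes t: "t \<ge> 2"
  shows "\<eta> (t + 1) \<le> 2 * (1 - b)\<^sup>2 * \<eta> t"
    and "\<eta> (t + 1) * \<tau> t \<le> (\<tau> (t - 1) + \<mu>) * \<eta> t"
    and "\<eta> (t + 1) * (4 * (L t)\<^sup>2) \<le> \<tau> t"
proof -
  have "t + 1 \<ge> 3" "t + 1 - 1 = t" "t + 1 - 2 = t - 1" using t by auto
  then have le1: "ereal (\<eta> (t + 1)) \<le> ereal (2 * (1 - b)\<^sup>2 * \<eta> t)"
    and le2: "ereal (\<eta> (t + 1)) \<le> ereal (\<tau> (t - 1) + \<mu>) / ereal (\<tau> t) * ereal (\<eta> t)"
    and le3: "ereal (\<eta> (t + 1)) \<le> ereal (\<tau> t) / ereal (4 * (L t)\<^sup>2)"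
    using rule unfolding stepsize_rule_def min.bounded_iff by metis+
  show "\<eta> (t + 1) \<le> 2 * (1 - b)\<^sup>2 * \<eta> t" using le1 by simp
  have "\<eta> (t + 1) > 0" "\<tau> t \<ge> 0" using eta_pos[of "t + 1"] tau_nonneg[of t] t by auto
  note * = pos_le_ereal_divide[OF this(1) _ this(2) le3]
  show "\<eta> (t + 1) * (4 * (L t)\<^sup>2) \<le> \<tau> t" using * by simp
  have "\<tau> t > 0" using * by simp
  then show "\<eta> (t + 1) * \<tau> t \<le> (\<tau> (t - 1) + \<mu>) * \<eta> t" using le2 by (simp add: field_simps)
qed

text \<open>What one iteration leaves over once the telescoping distances and the dual prox terms are
  split off. The first term stems from replacing \<open>f (x t)\<close> by \<open>f (x (t + 1))\<close>, the
  third from replacing \<open>y (t - 1)\<close> by \<open>y t\<close> in the coupling.\<close>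

definition residual :: "nat \<Rightarrow> real" where
  "residual t = \<eta> (t + 1) / \<eta> t * inner (xb (t - 1) - x t) (x t - x (t + 1))
     - (1 - b / 2) * (norm (xb t - x (t + 1)))\<^sup>2
     + \<eta> (t + 1) * inner (y t - y (t - 1)) (A *v (x t - x (t + 1)))
     - \<eta> (t + 1) * \<tau> t / 2 * (norm (y t - y (t - 1)))\<^sup>2"

definition primal_move :: "nat \<Rightarrow> real" where
  "primal_move t = (norm (xb (t - 1) - x t))\<^sup>2"

text \<open>The step for \<open>x (t + 1)\<close> uses \<open>y t\<close>, so it is the inequality for step \<open>t + 1\<close> that
  pairs with the dual inequality at \<open>t\<close>. It controls \<open>f (x (t + 1))\<close> in place of
  \<open>f (x t)\<close>; the primal inequality at \<open>t\<close>, tested at \<open>x (t + 1)\<close>, bounds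
  the difference. The averaging rule turns distances from \<open>x (t + 1)\<close> to \<open>u\<close>
  into distances between the points \<open>xb\<close>, which telescope.\<close>

lemma one_step:
  assumes t: "t \<ge> 1" and u: "u \<in> X" and v: "v \<in> Y"
  shows "\<eta> (t + 1) * (gap A f g (x t, y t) (u, v)
           + \<mu> / 2 * (norm (y0t - y t))\<^sup>2 - \<mu> / 2 * (norm (y0t - v))\<^sup>2
           + ((\<mu> + \<tau> t) * (norm (y t - v))\<^sup>2 - \<tau> t * (norm (y (t - 1) - v))\<^sup>2) / 2)
       \<le> ((norm (xb t - u))\<^sup>2 - (norm (xb (t + 1) - u))\<^sup>2) / (2 * b) + residual t"
proof -
  define \<eta>' where "\<eta>' = \<eta> (t + 1)"
  have eta: "\<eta> t > 0" "\<eta>' > 0" using eta_pos t by (auto simp: \<eta>'_def)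
  define F where "F = inner (y t) (A *v (x (t + 1) - u)) + f (x (t + 1)) - f u"
  define G where "G = inner (y (t - 1)) (A *v (x t - x (t + 1))) + f (x t) - f (x (t + 1))"
  define H where "H = inner (A *v x t) (v - y t) + g (y t) - g v"
  define K where "K = inner (y t - y (t - 1)) (A *v (x t - x (t + 1)))"
  define S where "S = inner (xb (t - 1) - x t) (x t - x (t + 1))"
  have gap: "gap A f g (x t, y t) (u, v) = F + G + H + K"
    unfolding gap_def F_def G_def H_def K_def
    by (simp add: matrix_vector_mult_diff_distrib inner_diff_right inner_diff_left inner_commute)
  have next_x: "\<eta>' * F \<le> ((norm (xb t - u))\<^sup>2 - (norm (xb (t + 1) - u))\<^sup>2) / (2 * b)
      - (1 - b / 2) * (norm (xb t - x (t + 1)))\<^sup>2"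
  proof -
    have "\<eta>' * F \<le> (norm (xb t - u))\<^sup>2 / 2 - (norm (xb t - x (t + 1)))\<^sup>2 / 2
        - (norm (x (t + 1) - u))\<^sup>2 / 2"
      using primal_prox[of "t + 1" u] u by (simp add: F_def \<eta>'_def)
    moreover have "(norm (xb (t + 1) - u))\<^sup>2 = (1 - b) * (norm (xb t - u))\<^sup>2
        + b * (norm (x (t + 1) - u))\<^sup>2 - b * (1 - b) * (norm (xb t - x (t + 1)))\<^sup>2"
      using norm_sq_convex_combination[of u b "xb t" "x (t + 1)"] xb_Suc[OF t]
      by (simp add: norm_minus_commute)
    then have "((norm (xb t - u))\<^sup>2 - (norm (xb (t + 1) - u))\<^sup>2) / (2 * b)
        = (norm (xb t - u))\<^sup>2 / 2 - (norm (x (t + 1) - u))\<^sup>2 / 2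
          - (norm (xb t - x (t + 1)))\<^sup>2 / 2 + (1 - b / 2) * (norm (xb t - x (t + 1)))\<^sup>2"
      using b_pos by (simp add: field_simps)
    ultimately show ?thesis by linarith
  qed
  have "\<eta> t * G \<le> S"
  proof -
    have "(norm (xb (t - 1) - x (t + 1)))\<^sup>2
        = (norm (xb (t - 1) - x t))\<^sup>2 + (norm (x t - x (t + 1)))\<^sup>2 + 2 * S"
      unfolding S_def power2_norm_eq_inner by (simp add: inner_diff_left inner_diff_right inner_commute)
    then show ?thesis using primal_prox[OF t x_in_X[of "t + 1"]] by (simp add: G_def)
  qed
  then have "G \<le> S / \<eta> t" using eta by (simp add: field_simps)
  then have this_x: "\<eta>' * G \<le> \<eta>' * (S / \<eta> t)" using eta by (intro mult_left_mono) auto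
  have "\<eta>' * (H + \<mu> / 2 * (norm (y0t - y t))\<^sup>2 + \<tau> t / 2 * (norm (y t - y (t - 1)))\<^sup>2
         + (\<mu> + \<tau> t) / 2 * (norm (y t - v))\<^sup>2)
       \<le> \<eta>' * (\<mu> / 2 * (norm (y0t - v))\<^sup>2 + \<tau> t / 2 * (norm (y (t - 1) - v))\<^sup>2)"
    using dual_prox[OF t v] eta
    by (intro mult_left_mono) (auto simp: H_def norm_minus_commute[of "y t" "y (t - Suc 0)"])
  with next_x this_x show ?thesis
    unfolding gap residual_def \<eta>'_def[symmetric] K_def[symmetric] S_def[symmetric]
    by (simp add: algebra_simps add_divide_distrib diff_divide_distrib)
qed

section \<open>Bounding the residuals\<close>

text \<open>The bound on \<open>\<eta> (t + 1)\<close> through the local norm estimate lets the dual prox term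
  absorb the coupling up to an eighth of the squared primal step, which is the slack of
  the quadratic form estimate.\<close>

lemma residual_later:
  assumes t: "t \<ge> 2"
  shows "residual t \<le> (primal_move t - primal_move (t + 1)) / 4"
proof -
  define \<eta>' where "\<eta>' = \<eta> (t + 1)"
  define d where "d = norm (y t - y (t - 1))"
  define p where "p = xb (t - 1) - x t"
  define w where "w = x t - x (t + 1)"
  have eta: "\<eta> t > 0" "\<eta>' > 0" using eta_pos t by (auto simp: \<eta>'_def)
  have "\<eta>' * inner (y t - y (t - 1)) (A *v w) \<le> (norm w)\<^sup>2 / 8 + \<eta>' * \<tau> t / 2 * d\<^sup>2"
  proof -
    have "\<eta>' * inner (y t - y (t - 1)) (A *v w) \<le> \<eta>' * (L t * d * norm w)"
      using coupling_bound[of t w] eta unfolding d_def by (intro mult_left_mono) auto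
    also have "\<dots> \<le> (norm w)\<^sup>2 / 8 + 2 * (\<eta>' * L t * d)\<^sup>2"
      using young_product[of "norm w" "2 * (\<eta>' * L t * d)"] by (simp add: power2_eq_square algebra_simps)
    also have "2 * (\<eta>' * L t * d)\<^sup>2 = \<eta>' * d\<^sup>2 / 2 * (\<eta>' * (4 * (L t)\<^sup>2))"
      by (simp add: power2_eq_square algebra_simps)
    also have "\<dots> \<le> \<eta>' * d\<^sup>2 / 2 * \<tau> t"
      using stepsize_later(3)[OF t] eta by (intro mult_left_mono) (auto simp: \<eta>'_def)
    finally show ?thesis by (simp add: algebra_simps)
  qed
  moreover have "xb t = (1 - b) *\<^sub>R xb (t - 1) + b *\<^sub>R x t"
    using xb_Suc[of "t - 1"] t by simp
  then have xb: "xb t - x (t + 1) = (1 - b) *\<^sub>R p + w"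
    by (simp add: p_def w_def algebra_simps)
  moreover have "\<eta>' / \<eta> t \<le> 2 * (1 - b)\<^sup>2"
    using stepsize_later(1)[OF t] eta by (simp add: \<eta>'_def field_simps)
  then have "(norm w)\<^sup>2 / 8 + \<eta>' / \<eta> t * inner p w - (1 - b / 2) * (norm ((1 - b) *\<^sub>R p + w))\<^sup>2
       \<le> ((norm p)\<^sup>2 - (norm ((1 - b) *\<^sub>R p + w))\<^sup>2) / 4"
    using eta by (intro extrapolation_form_bound b_pos b_less_1) auto
  ultimately show ?thesis
    unfolding residual_def primal_move_def \<eta>'_def[symmetric] p_def[symmetric] w_def[symmetric]
      d_def[symmetric] by (simp add: xb)
qed

text \<open>As \<open>\<tau> 1 = 0\<close>, the points \<open>y 0\<close> and \<open>y 1\<close> minimise the same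
  \<open>\<mu>\<close>-strongly convex function up to a linear term, so their distance is at most
  the distance of the linear terms divided by \<open>\<mu>\<close>.\<close>

lemma first_dual_move: "\<mu> * norm (y 1 - y 0) \<le> L 1 * norm (x 1 - x 0)"
proof -
  define d where "d = norm (y 1 - y 0)"
  have "inner (y 1 - y 0) (A *v (x 1 - x 0)) \<ge> \<mu> * d\<^sup>2"
    using dual_prox_0[OF y_in_Y[of 1]] dual_prox[OF _ y_in_Y[of 0], of 1]
    by (simp add: tau_1[simplified] d_def norm_minus_commute[of "y 0" "y (Suc 0)"] inner_diff_right inner_diff_left
        matrix_vector_mult_diff_distrib inner_commute)
  also have "inner (y 1 - y 0) (A *v (x 1 - x 0)) \<le> L 1 * d * norm (x 1 - x 0)"
    using coupling_bound[of 1 "x 1 - x 0"] by (simp add: d_def)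
  finally have "d * (\<mu> * d) \<le> d * (L 1 * norm (x 1 - x 0))"
    by (simp add: power2_eq_square algebra_simps)
  then show ?thesis
    using local_norm_nonneg[of 1] by (cases "d = 0") (auto simp: d_def)
qed

text \<open>Here there is no dual prox term to absorb the coupling; the bound on \<open>y 1 - y 0\<close>
  takes its place and is paid for with a multiple of \<open>(norm (x 1 - x 0))\<^sup>2\<close>. As
  \<open>xb 0\<close> and \<open>xb 1\<close> both equal \<open>x 0\<close>, what remains is a multiple of
  \<open>(norm (x 0 - x 2))\<^sup>2\<close>, that is, of \<open>primal_move 2\<close>, and its coefficient comes
  out as the \<open>- 1 / 4\<close> that the later residuals need in order to telescope.\<close>

lemma residual_first:
  "residual 1 \<le> (5 * \<eta> 2 * (L 1)\<^sup>2 / (4 * \<mu>) - \<eta> 2 / (2 * \<eta> 1)) * (norm (x 1 - x 0))\<^sup>2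
     - primal_move 2 / 4"
proof -
  define r where "r = norm (x 1 - x 0)"
  define e where "e = norm (x 1 - x 2)"
  define s where "s = norm (x 0 - x 2)"
  define q where "q = \<eta> 2 * (L 1)\<^sup>2 / \<mu>"
  define \<theta> where "\<theta> = \<eta> 2 / \<eta> 1"
  have eta: "\<eta> 1 > 0" "\<eta> 2 > 0" using eta_pos by auto
  have q: "0 \<le> q" "q \<le> 1 / 4"
    using eta mu_pos stepsize_first(2) by (auto simp: q_def field_simps)
  have \<theta>: "0 \<le> \<theta>" "\<theta> \<le> 1 - b"
    using eta stepsize_first(1) by (auto simp: \<theta>_def field_simps)
  have e: "e \<le> r + s"
    using norm_triangle_ineq[of "x 1 - x 0" "x 0 - x 2"] by (simp add: e_def r_def s_def)
  have "\<eta> 2 * inner (y 1 - y 0) (A *v (x 1 - x 2)) \<le> 5 / 4 * q * r\<^sup>2 + s\<^sup>2 / 4"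
  proof -
    have "norm (y 1 - y 0) \<le> L 1 * r / \<mu>"
      using first_dual_move mu_pos by (simp add: r_def field_simps)
    then have "L 1 * norm (y 1 - y 0) * e \<le> L 1 * (L 1 * r / \<mu>) * e"
      using local_norm_nonneg by (intro mult_left_mono mult_right_mono) (auto simp: e_def)
    then have "inner (y 1 - y 0) (A *v (x 1 - x 2)) \<le> L 1 * (L 1 * r / \<mu>) * e"
      using coupling_bound[of 1 "x 1 - x 2"] by (simp add: e_def)
    then have "\<eta> 2 * inner (y 1 - y 0) (A *v (x 1 - x 2)) \<le> \<eta> 2 * (L 1 * (L 1 * r / \<mu>) * e)"
      using eta by (intro mult_left_mono) auto
    also have "\<dots> = q * (r * e)" by (simp add: q_def power2_eq_square)
    \<comment> \<open>The \<open>5 / 4\<close> of the theorem: \<open>1\<close> from the triangle inequality for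
      \<open>e\<close>, \<open>1 / 4\<close> from splitting \<open>r * s\<close>.\<close>
    also have "r * e \<le> 5 / 4 * r\<^sup>2 + s\<^sup>2"
    proof -
      have "r * e \<le> r * (r + s)" using e by (intro mult_left_mono) (auto simp: r_def)
      also have "\<dots> \<le> r\<^sup>2 + (r\<^sup>2 / 4 + s\<^sup>2)"
        using young_product[of r s] by (simp add: power2_eq_square algebra_simps)
      finally show ?thesis by simp
    qed
    then have "q * (r * e) \<le> q * (5 / 4 * r\<^sup>2 + s\<^sup>2)" using q by (intro mult_left_mono) auto
    also have "\<dots> = 5 / 4 * q * r\<^sup>2 + q * s\<^sup>2" by (simp add: algebra_simps)
    also have "q * s\<^sup>2 \<le> 1 / 4 * s\<^sup>2" using q by (intro mult_right_mono) auto
    finally show ?thesis by simp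
  qed
  moreover have "\<theta> * inner (x 0 - x 1) (x 1 - x 2) \<le> (1 - b) / 2 * s\<^sup>2 - \<theta> / 2 * r\<^sup>2"
  proof -
    have "s\<^sup>2 = r\<^sup>2 + e\<^sup>2 + 2 * inner (x 0 - x 1) (x 1 - x 2)"
      unfolding s_def r_def e_def power2_norm_eq_inner
      by (simp add: inner_diff_left inner_diff_right inner_commute)
    then have "inner (x 0 - x 1) (x 1 - x 2) \<le> (s\<^sup>2 - r\<^sup>2) / 2" by simp
    then have "\<theta> * inner (x 0 - x 1) (x 1 - x 2) \<le> \<theta> * ((s\<^sup>2 - r\<^sup>2) / 2)"
      using \<theta> by (intro mult_left_mono)
    moreover have "\<theta> * s\<^sup>2 \<le> (1 - b) * s\<^sup>2" using \<theta> by (intro mult_right_mono) auto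
    ultimately show ?thesis by (simp add: algebra_simps diff_divide_distrib)
  qed
  moreover have "residual 1 = \<theta> * inner (x 0 - x 1) (x 1 - x 2) - (1 - b / 2) * s\<^sup>2
      + \<eta> 2 * inner (y 1 - y 0) (A *v (x 1 - x 2))"
    using xb_0 xb_1 tau_1 unfolding residual_def s_def \<theta>_def by (simp add: numeral_2_eq_2)
  moreover have "primal_move 2 = s\<^sup>2"
    using xb_1 by (simp add: primal_move_def s_def)
  moreover have "(5 * \<eta> 2 * (L 1)\<^sup>2 / (4 * \<mu>) - \<eta> 2 / (2 * \<eta> 1)) * (norm (x 1 - x 0))\<^sup>2
      = 5 / 4 * q * r\<^sup>2 - \<theta> / 2 * r\<^sup>2"
    by (simp add: q_def \<theta>_def r_def left_diff_distrib)
  ultimately show ?thesis by (simp add: algebra_simps diff_divide_distrib)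
qed

lemma sum_residual:
  assumes "k \<ge> 1"
  shows "(\<Sum>t=1..k. residual t)
       \<le> (5 * \<eta> 2 * (L 1)\<^sup>2 / (4 * \<mu>) - \<eta> 2 / (2 * \<eta> 1)) * (norm (x 1 - x 0))\<^sup>2
         - primal_move (k + 1) / 4"
  using assms
proof (induction k rule: nat_induct_at_least)
  case base
  then show ?case using residual_first by (simp add: numeral_2_eq_2)
next
  case (Suc k)
  then show ?case using residual_later[of "Suc k"] by (simp add: diff_divide_distrib)
qed

section \<open>Averaging the iterates\<close>

lemma step_sum_pos:
  assumes "k \<ge> 1"
  shows "step_sum \<eta> k > 0"
  unfolding step_sum_def using assms eta_pos by (intro sum_pos) auto

text \<open>The bound of the step-size rule on the growth of \<open>\<eta> (t + 1) * \<tau> t\<close> serves to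
  make \<^const>\<open>y_tilde\<close> a genuine convex combination of dual iterates.\<close>

lemma dual_weight_nonneg:
  assumes "t \<ge> 1"
  shows "dual_weight \<mu> \<eta> \<tau> k t \<ge> 0"
proof (cases "t < k")
  case True
  then show ?thesis
    using stepsize_later(2)[of "t + 1"] assms by (simp add: dual_weight_def algebra_simps)
next
  case False
  then show ?thesis
    using eta_pos[of "t + 1"] tau_nonneg[OF assms] mu_pos by (simp add: dual_weight_def)
qed

lemma gap_average:
  assumes k: "k \<ge> 1"
  shows "step_sum \<eta> k * gap A f g (step_avg \<eta> x k, step_avg \<eta> y k) (u, v)
       \<le> (\<Sum>t=1..k. \<eta> (t + 1) * gap A f g (x t, y t) (u, v))"
proof -
  let ?S = "step_sum \<eta> k"
  have S: "(\<Sum>t=1..k. \<eta> (t + 1)) = ?S" "?S > 0" "?S \<noteq> 0"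
    using step_sum_pos[OF k] by (auto simp: step_sum_def)
  have fx: "?S * f (step_avg \<eta> x k) \<le> (\<Sum>t=1..k. \<eta> (t + 1) * f (x t))"
    unfolding step_avg_def
    by (rule Jensen_weighted_sum[OF _ convex_f]) (use S x_in_X eta_pos in \<open>auto simp: less_imp_le\<close>)
  have gy: "?S * g (step_avg \<eta> y k) \<le> (\<Sum>t=1..k. \<eta> (t + 1) * g (y t))"
    unfolding step_avg_def
    by (rule Jensen_weighted_sum[OF _ convex_g]) (use S y_in_Y eta_pos in \<open>auto simp: less_imp_le\<close>)
  have Ax: "?S * inner (A *v step_avg \<eta> x k) v = (\<Sum>t=1..k. \<eta> (t + 1) * inner (A *v x t) v)"
    using S by (simp add: step_avg_def inner_sum_left matrix_vector_mult_scaleR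
        linear_sum[OF matrix_vector_mul_linear, unfolded o_def])
  have yA: "?S * inner (A *v u) (step_avg \<eta> y k) = (\<Sum>t=1..k. \<eta> (t + 1) * inner (A *v u) (y t))"
    using S by (simp add: step_avg_def inner_sum_right)
  have "(\<Sum>t=1..k. \<eta> (t + 1) * gap A f g (x t, y t) (u, v))
      = (\<Sum>t=1..k. \<eta> (t + 1) * f (x t)) + (\<Sum>t=1..k. \<eta> (t + 1) * inner (A *v x t) v)
        - ?S * g v - ?S * f u - (\<Sum>t=1..k. \<eta> (t + 1) * inner (A *v u) (y t))
        + (\<Sum>t=1..k. \<eta> (t + 1) * g (y t))"
    unfolding S(1)[symmetric] sum_distrib_right sum.distrib[symmetric] sum_subtractf[symmetric]
    by (intro sum.cong refl) (simp add: gap_def ring_distribs)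
  then show ?thesis using fx gy Ax yA by (simp add: gap_def algebra_simps)
qed

lemma prox_center_average:
  assumes k: "k \<ge> 1"
  shows "step_sum \<eta> k * (norm (y0t - step_avg \<eta> y k))\<^sup>2
       \<le> (\<Sum>t=1..k. \<eta> (t + 1) * (norm (y0t - y t))\<^sup>2)"
proof -
  have "0 \<le> \<eta> (t + 1)" for t using eta_pos[of "t + 1"] by simp
  then show ?thesis
    unfolding step_avg_def using step_sum_pos[OF k]
    by (intro Jensen_weighted_sum[of "{1..k}" UNIV "\<lambda>w. (norm (y0t - w))\<^sup>2"]
        convex_on_norm_sq_diff) (simp_all add: step_sum_def)
qed

lemma y_tilde_average:
  assumes k: "k \<ge> 1"
  shows "\<mu> * step_sum \<eta> k * (norm (y_tilde \<mu> \<eta> \<tau> y k - v))\<^sup>2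
       \<le> (\<Sum>t=1..k. dual_weight \<mu> \<eta> \<tau> k t * (norm (y t - v))\<^sup>2)"
proof -
  have "y_tilde \<mu> \<eta> \<tau> y k
      = (1 / (\<mu> * step_sum \<eta> k)) *\<^sub>R (\<Sum>t=1..k. dual_weight \<mu> \<eta> \<tau> k t *\<^sub>R y t)"
    unfolding y_tilde_def sum_dual_weight[OF k] ..
  then show ?thesis
    unfolding norm_minus_commute[of _ v]
    using dual_weight_total[where k = k and \<tau> = \<tau>, OF k tau_1] dual_weight_nonneg mu_pos
      step_sum_pos[OF k]
    by (auto intro!: Jensen_weighted_sum[where h = "\<lambda>w. (norm (v - w))\<^sup>2",
        OF _ convex_on_norm_sq_diff])
qed

lemma averaged_gap_bound:
  assumes k: "k \<ge> 1" and u: "u \<in> X" and v: "v \<in> Y"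
  shows "gap A f g (step_avg \<eta> x k, step_avg \<eta> y k) (u, v)
           - \<mu> / 2 * (norm (y0t - v))\<^sup>2
           + \<mu> / 2 * (norm (y0t - step_avg \<eta> y k))\<^sup>2
           + \<mu> / 2 * (norm (y_tilde \<mu> \<eta> \<tau> y k - v))\<^sup>2
         \<le> 1 / step_sum \<eta> k *
             ((norm (x 0 - u))\<^sup>2 / (2 * b)
              + (5 * \<eta> 2 * (L 1)\<^sup>2 / (4 * \<mu>) - \<eta> 2 / (2 * \<eta> 1)) * (norm (x 1 - x 0))\<^sup>2
              - (norm (xb (k + 1) - u))\<^sup>2 / (2 * b))"
    (is "?lhs \<le> 1 / _ * ?rhs")
proof -
  let ?S = "step_sum \<eta> k"
  let ?Q = "\<lambda>t. gap A f g (x t, y t) (u, v)"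
  let ?N = "\<lambda>t. (norm (y t - v))\<^sup>2"
  have S: "?S > 0" by (rule step_sum_pos[OF k])
  have "?S * ?lhs = ?S * gap A f g (step_avg \<eta> x k, step_avg \<eta> y k) (u, v)
      - \<mu> / 2 * (?S * (norm (y0t - v))\<^sup>2)
      + \<mu> / 2 * (?S * (norm (y0t - step_avg \<eta> y k))\<^sup>2)
      + \<mu> * ?S * (norm (y_tilde \<mu> \<eta> \<tau> y k - v))\<^sup>2 / 2"
    by (simp add: algebra_simps)
  also have "\<dots> \<le> (\<Sum>t=1..k. \<eta> (t + 1) * ?Q t)
      - \<mu> / 2 * (?S * (norm (y0t - v))\<^sup>2)
      + \<mu> / 2 * (\<Sum>t=1..k. \<eta> (t + 1) * (norm (y0t - y t))\<^sup>2)
      + (\<Sum>t=1..k. dual_weight \<mu> \<eta> \<tau> k t * ?N t) / 2"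
    using mu_pos S
    by (intro add_mono diff_mono mult_left_mono divide_right_mono gap_average[OF k]
        prox_center_average[OF k] y_tilde_average[OF k]) auto
  also have "\<dots> = (\<Sum>t=1..k. \<eta> (t + 1) * (?Q t
           + \<mu> / 2 * (norm (y0t - y t))\<^sup>2 - \<mu> / 2 * (norm (y0t - v))\<^sup>2
           + ((\<mu> + \<tau> t) * ?N t - \<tau> t * ?N (t - 1)) / 2))"
    unfolding dual_weight_summation[where N = ?N and k = k and \<tau> = \<tau>, OF k tau_1, symmetric] step_sum_def
      sum_distrib_left sum_distrib_right sum_divide_distrib
      sum.distrib[symmetric] sum_subtractf[symmetric]
    by (intro sum.cong refl) (simp add: algebra_simps diff_divide_distrib add_divide_distrib)
  also have "\<dots> \<le> (\<Sum>t=1..k. ((norm (xb t - u))\<^sup>2 - (norm (xb (t + 1) - u))\<^sup>2) / (2 * b) + residual t)"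
    using u v by (intro sum_mono one_step) auto
  also have "\<dots> = ((norm (x 0 - u))\<^sup>2 - (norm (xb (k + 1) - u))\<^sup>2) / (2 * b) + (\<Sum>t=1..k. residual t)"
  proof -
    have "(\<Sum>t=1..k. (norm (xb t - u))\<^sup>2 - (norm (xb (t + 1) - u))\<^sup>2)
        = (norm (xb 1 - u))\<^sup>2 - (norm (xb (k + 1) - u))\<^sup>2"
      using k by (induction k rule: nat_induct_at_least) auto
    then show ?thesis by (simp only: sum.distrib sum_divide_distrib[symmetric] xb_1)
  qed
  also have "\<dots> \<le> ?rhs"
  proof -
    have "primal_move (k + 1) \<ge> 0" by (simp add: primal_move_def)
    then show ?thesis using sum_residual[OF k] by (simp add: diff_divide_distrib)
  qed
  finally show ?thesis using S by (simp add: field_simps)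
qed

end

theorem theorem2p3:
  fixes X :: "(real^'n) set" and Y :: "(real^'m) set"
    and A :: "real^'n^'m"
    and f :: "real^'n \<Rightarrow> real" and g :: "real^'m \<Rightarrow> real"
    and \<mu> b :: real and \<beta> \<eta> \<tau> :: "nat \<Rightarrow> real"
    and y0t :: "real^'m"
    and x xb :: "nat \<Rightarrow> real^'n" and y :: "nat \<Rightarrow> real^'m"
    and k :: nat and u :: "real^'n" and v :: "real^'m"
  assumes "X \<noteq> {}" "closed X" "convex X"
    and "Y \<noteq> {}" "closed Y" "convex Y"
    and "convex_on X f" "lsc_on X f"
    and "convex_on Y g" "lsc_on Y g"
    and "\<exists>zs. is_saddle_point X Y (\<lambda>x y. f x + inner (A *v x) y - g y) zs"
    and "\<mu> > 0" "0 < b" "b < 1"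
    and "\<And>t. t \<ge> 1 \<Longrightarrow> \<eta> t > 0"
    and "\<And>t. t \<ge> 1 \<Longrightarrow> \<tau> t \<ge> 0"
    and "\<tau> 1 = 0" "\<beta> 1 = 0" "\<And>t. t \<ge> 2 \<Longrightarrow> \<beta> t = b"
    and "ac_pdhg X Y A f g \<mu> \<beta> \<eta> \<tau> y0t x xb y"
    and "stepsize_rule \<mu> b (local_norm A y) \<eta> \<tau>"
    and "k \<ge> 2" and "(u, v) \<in> X \<times> Y"
  shows "gap A f g (step_avg \<eta> x k, step_avg \<eta> y k) (u, v)
           - \<mu> / 2 * (norm (y0t - v))\<^sup>2
           + \<mu> / 2 * (norm (y0t - step_avg \<eta> y k))\<^sup>2
           + \<mu> / 2 * (norm (y_tilde \<mu> \<eta> \<tau> y k - v))\<^sup>2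
         \<le> 1 / step_sum \<eta> k *
             ((norm (x 0 - u))\<^sup>2 / (2 * b)
              + (5 * \<eta> 2 * (local_norm A y 1)\<^sup>2 / (4 * \<mu>) - \<eta> 2 / (2 * \<eta> 1))
                  * (norm (x 1 - x 0))\<^sup>2
              - (norm (xb (k + 1) - u))\<^sup>2 / (2 * b))"
proof -
  interpret ac_pdhg_run X Y A f g \<mu> b \<beta> \<eta> \<tau> y0t x xb y
    by unfold_locales fact+
  from averaged_gap_bound[of k u v] \<open>k \<ge> 2\<close> \<open>(u, v) \<in> X \<times> Y\<close>
  show ?thesis by simp
qed

end
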